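(* Let $\hat\xi$ be the dominant scenario. Suppose $\mu\in\mathbb{R}$, $y\in\{0,1\}^{I\times J}$ and $\hat x\in\mathbb{R}^{I\times J}$ satisfy the dominant flow constraints $$\mu\le\sum_{i\in I}\sum_{j\in J}q_{i,j}\,\hat x_{i,j},\qquad \sum_{j\in J}r_{i,j}\,\hat x_{i,j}\le\hat\xi^c_i\ \ \forall i\in I,\qquad \sum_{i\in I}\hat x_{i,j}\le\hat\xi^d_j\ \ \forall j\in J,\qquad 0\le\hat x_{i,j}\le M^{\hat\xi}_{i,j}\,y_{i,j}\ \ \forall i\in I,\ j\in J.$$ Then for every vertex $(\alpha,\beta,\rho)$ of the polyhedron $\mathcal{T}$, the dominant-scenario cut holds: $$\mu\le\sum_{i\in I}\hat\xi^c_i\,\alpha_i+\sum_{j\in J}\hat\xi^d_j\,\beta_j+\sum_{(i,j)\in I\times J}M^{\hat\xi}_{i,j}\,\rho_{i,j}\,y_{i,j}.$$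
   Context: $I$ (plants) and $J$ (products) are finite nonempty sets. For $(i,j)\in I\times J$, $q_{i,j}\ge 0$ is the unit profit and $r_{i,j}>0$ the unit processing time. For each design $y\in\{0,1\}^{I\times J}$ there is a probability distribution $\mathbb{P}_y$ of a random vector $\Xi=(\Xi^c,\Xi^d)$ with nonnegative entries and finite means, where $\Xi^c=(\Xi^c_i)_{i\in I}$ are plant capacities and $\Xi^d=(\Xi^d_j)_{j\in J}$ are product demands. Let $\mathcal{P}=\{\mathbb{P}_y : y\in\{0,1\}^{I\times J}\}$ (a finite set). The dominant scenario $\hat\xi=(\hat\xi^c,\hat\xi^d)$ is the componentwise maximum of expectations: $\hat\xi^c_i=\max_{p\in\mathcal{P}}\mathbb{E}_{\Xi\sim p}[\Xi^c_i]$ and $\hat\xi^d_j=\max_{p\in\mathcal{P}}\mathbb{E}_{\Xi\sim p}[\Xi^d_j]$. For a vector $\xi=(\xi^c,\xi^d)$, $M^{\xi}_{i,j}=\min\{\xi^c_i/r_{i,j},\ \xi^d_j\}$. $\mathcal{T}=\{(\alpha,\beta,\rho)\in\mathbb{R}^I_{\ge0}\times\mathbb{R}^J_{\ge0}\times\mathbb{R}^{I\times J}_{\ge0} : r_{i,j}\alpha_i+\beta_j+\rho_{i,j}\ge q_{i,j}\ \ \forall i\in I,\ j\in J\}$ (the dual feasible region of the second-stage production problem). *)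

theory Defs
  imports "HOL-Probability.Probability"
begin

text \<open>
  The finite nonempty index sets of plants and products are the universes of the finite types
  \<open>'i\<close> and \<open>'j\<close>. An \<open>I \<times> J\<close> array is a \<open>real^'j^'i\<close>, its \<open>(i, j)\<close> entry being \<open>q $ i $ j\<close>.
  A scenario is a pair of plant capacities and product demands.
\<close>

type_synonym ('i, 'j) scenario = "(real^'i) \<times> (real^'j)"

definition designs :: "(real^'j^'i) set" where
  "designs = {y. \<forall>i j. y $ i $ j \<in> {0, 1}}"

definition scenario_distribution :: "('i::finite, 'j::finite) scenario measure \<Rightarrow> bool" where
  "scenario_distribution p \<longleftrightarrow>
     prob_space p \<and> sets p = sets borel \<and>
     (AE \<Xi> in p. (\<forall>i. 0 \<le> fst \<Xi> $ i) \<and> (\<forall>j. 0 \<le> snd \<Xi> $ j)) \<and>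
     (\<forall>i. integrable p (\<lambda>\<Xi>. fst \<Xi> $ i)) \<and> (\<forall>j. integrable p (\<lambda>\<Xi>. snd \<Xi> $ j))"

definition dominant_scenario ::
    "('i::finite, 'j::finite) scenario measure set \<Rightarrow> ('i, 'j) scenario" where
  "dominant_scenario \<P> =
     (\<chi> i. Max ((\<lambda>p. LINT \<Xi>|p. fst \<Xi> $ i) ` \<P>), \<chi> j. Max ((\<lambda>p. LINT \<Xi>|p. snd \<Xi> $ j) ` \<P>))"

definition flow_bound ::
    "real^'j^'i \<Rightarrow> ('i::finite, 'j::finite) scenario \<Rightarrow> 'i \<Rightarrow> 'j \<Rightarrow> real" where
  "flow_bound r \<xi> i j = min (fst \<xi> $ i / r $ i $ j) (snd \<xi> $ j)"

definition dual_region ::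
    "real^'j^'i \<Rightarrow> real^'j^'i \<Rightarrow> ((real^'i::finite) \<times> (real^'j::finite) \<times> (real^'j^'i)) set" where
  "dual_region q r = {(\<alpha>, \<beta>, \<rho>).
     (\<forall>i. 0 \<le> \<alpha> $ i) \<and> (\<forall>j. 0 \<le> \<beta> $ j) \<and> (\<forall>i j. 0 \<le> \<rho> $ i $ j) \<and>
     (\<forall>i j. r $ i $ j * \<alpha> $ i + \<beta> $ j + \<rho> $ i $ j \<ge> q $ i $ j)}"

text \<open>The maxima in \<^const>\<open>dominant_scenario\<close> range over finite nonempty sets when
  the family of distributions is indexed by the designs.\<close>

lemma finite_designs: "finite (designs :: (real^'j::finite^'i::finite) set)"
proof -
  have "finite {f :: 'i \<Rightarrow> 'j \<Rightarrow> real. \<forall>i. f i \<in> {g. \<forall>j. g j \<in> {0, 1}}}"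
    using finite_set_of_finite_funs[of "UNIV :: 'j set" "{0, 1 :: real}"]
      finite_set_of_finite_funs[of "UNIV :: 'i set" "{g :: 'j \<Rightarrow> real. \<forall>j. g j \<in> {0, 1}}"]
    by simp
  then have "finite ((\<lambda>f. \<chi> i j. f i j) ` {f :: 'i \<Rightarrow> 'j \<Rightarrow> real. \<forall>i j. f i j \<in> {0, 1}})"
    by simp
  moreover have "designs \<subseteq> (\<lambda>f. \<chi> i j. f i j) ` {f :: 'i \<Rightarrow> 'j \<Rightarrow> real. \<forall>i j. f i j \<in> {0, 1}}"
  proof
    fix y :: "real^'j^'i"
    assume "y \<in> designs"
    then show "y \<in> (\<lambda>f. \<chi> i j. f i j) ` {f. \<forall>i j. f i j \<in> {0, 1}}"
      by (intro image_eqI[where x = "\<lambda>i j. y $ i $ j"]) (simp_all add: designs_def)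
  qed
  ultimately show ?thesis
    by (rule rev_finite_subset)
qed

lemma designs_nonempty: "designs \<noteq> {}"
proof -
  have "0 \<in> designs"
    by (simp add: designs_def)
  then show ?thesis
    by blast
qed

end

theory Submission
  imports Defs
begin

text \<open>
  The cut is weak linear programming duality for the production problem in which the plants have
  capacities \<open>fst \<xi>\<close>, the products have demands \<open>snd \<xi>\<close> and the flow from \<open>i\<close> to \<open>j\<close> is at most
  \<open>flow_bound r \<xi> i j * y $ i $ j\<close>. The dominant flow constraints say that \<open>x\<close> is a feasible
  production plan of profit at least \<open>\<mu>\<close>. A point of \<^const>\<open>dual_region\<close> prices capacity, demand and
  flow bounds so that the resources taken up by a unit of flow from \<open>i\<close> to \<open>j\<close> cost at least its
  profit \<open>q $ i $ j\<close>. Hence the profit of \<open>x\<close> is at most the cost of the resources that it uses,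
  which is at most the cost of the resources available: the right-hand side of the cut. The vertices
  of \<^const>\<open>dual_region\<close> are among its points, so the cut holds at each of them.
\<close>

text \<open>
  Multiplying the dual constraint at \<open>(i, j)\<close> by the flow \<open>x $ i $ j \<ge> 0\<close> and summing bounds the
  profit by the cost of the resources used. Regrouping this cost by plant, by product and by arc lets
  each primal constraint be applied with its nonnegative price.
\<close>

lemma production_weak_duality:
  fixes q r x :: "real^'j::finite^'i::finite"
  assumes dual: "(\<alpha>, \<beta>, \<rho>) \<in> dual_region q r"
    and capacity: "\<And>i. (\<Sum>j\<in>UNIV. r $ i $ j * x $ i $ j) \<le> c i"
    and demand: "\<And>j. (\<Sum>i\<in>UNIV. x $ i $ j) \<le> d j"
    and flow: "\<And>i j. 0 \<le> x $ i $ j" "\<And>i j. x $ i $ j \<le> u i j"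
  shows "(\<Sum>i\<in>UNIV. \<Sum>j\<in>UNIV. q $ i $ j * x $ i $ j)
    \<le> (\<Sum>i\<in>UNIV. c i * \<alpha> $ i) + (\<Sum>j\<in>UNIV. d j * \<beta> $ j)
      + (\<Sum>i\<in>UNIV. \<Sum>j\<in>UNIV. u i j * \<rho> $ i $ j)"
proof -
  have price_nonneg: "0 \<le> \<alpha> $ i" "0 \<le> \<beta> $ j" "0 \<le> \<rho> $ i $ j"
    and price_covers: "q $ i $ j \<le> r $ i $ j * \<alpha> $ i + \<beta> $ j + \<rho> $ i $ j" for i j
    using dual by (auto simp: dual_region_def)
  have "(\<Sum>i\<in>UNIV. \<Sum>j\<in>UNIV. q $ i $ j * x $ i $ j)
      \<le> (\<Sum>i\<in>UNIV. \<Sum>j\<in>UNIV. (r $ i $ j * \<alpha> $ i + \<beta> $ j + \<rho> $ i $ j) * x $ i $ j)"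
    by (intro sum_mono mult_right_mono price_covers flow)
  also have "\<dots> = (\<Sum>i\<in>UNIV. \<Sum>j\<in>UNIV. r $ i $ j * x $ i $ j * \<alpha> $ i)
      + (\<Sum>i\<in>UNIV. \<Sum>j\<in>UNIV. x $ i $ j * \<beta> $ j)
      + (\<Sum>i\<in>UNIV. \<Sum>j\<in>UNIV. x $ i $ j * \<rho> $ i $ j)"
    by (simp add: sum.distrib [symmetric] algebra_simps)
  also have "(\<Sum>i\<in>UNIV. \<Sum>j\<in>UNIV. x $ i $ j * \<beta> $ j)
      = (\<Sum>j\<in>UNIV. \<Sum>i\<in>UNIV. x $ i $ j * \<beta> $ j)"
    by (rule sum.swap)
  also have "(\<Sum>i\<in>UNIV. \<Sum>j\<in>UNIV. r $ i $ j * x $ i $ j * \<alpha> $ i)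
      + (\<Sum>j\<in>UNIV. \<Sum>i\<in>UNIV. x $ i $ j * \<beta> $ j)
      + (\<Sum>i\<in>UNIV. \<Sum>j\<in>UNIV. x $ i $ j * \<rho> $ i $ j)
    \<le> (\<Sum>i\<in>UNIV. c i * \<alpha> $ i) + (\<Sum>j\<in>UNIV. d j * \<beta> $ j)
      + (\<Sum>i\<in>UNIV. \<Sum>j\<in>UNIV. u i j * \<rho> $ i $ j)"
    unfolding sum_distrib_right [symmetric]
    by (intro add_mono sum_mono mult_right_mono capacity demand flow price_nonneg)
  finally show ?thesis .
qed

theorem proposition4:
  fixes q r :: "real^'j::finite^'i::finite"
    and P :: "real^'j^'i \<Rightarrow> ('i, 'j) scenario measure"
    and \<xi> :: "('i, 'j) scenario"
    and \<mu> :: real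
    and y x :: "real^'j^'i"
    and \<alpha> :: "real^'i" and \<beta> :: "real^'j" and \<rho> :: "real^'j^'i"
  assumes "\<And>i j. 0 \<le> q $ i $ j"
    and "\<And>i j. 0 < r $ i $ j"
    and "\<And>y'. y' \<in> designs \<Longrightarrow> scenario_distribution (P y')"
    and "\<xi> = dominant_scenario (P ` designs)"
    and "y \<in> designs"
    and "\<mu> \<le> (\<Sum>i\<in>UNIV. \<Sum>j\<in>UNIV. q $ i $ j * x $ i $ j)"
    and "\<And>i. (\<Sum>j\<in>UNIV. r $ i $ j * x $ i $ j) \<le> fst \<xi> $ i"
    and "\<And>j. (\<Sum>i\<in>UNIV. x $ i $ j) \<le> snd \<xi> $ j"
    and "\<And>i j. 0 \<le> x $ i $ j \<and> x $ i $ j \<le> flow_bound r \<xi> i j * y $ i $ j"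
    and "(\<alpha>, \<beta>, \<rho>) extreme_point_of dual_region q r"
  shows "\<mu> \<le> (\<Sum>i\<in>UNIV. fst \<xi> $ i * \<alpha> $ i) + (\<Sum>j\<in>UNIV. snd \<xi> $ j * \<beta> $ j)
           + (\<Sum>(i, j)\<in>UNIV. flow_bound r \<xi> i j * \<rho> $ i $ j * y $ i $ j)"
proof -
  have "(\<alpha>, \<beta>, \<rho>) \<in> dual_region q r"
    using assms(10) by (simp add: extreme_point_of_def)
  then have "(\<Sum>i\<in>UNIV. \<Sum>j\<in>UNIV. q $ i $ j * x $ i $ j)
      \<le> (\<Sum>i\<in>UNIV. fst \<xi> $ i * \<alpha> $ i) + (\<Sum>j\<in>UNIV. snd \<xi> $ j * \<beta> $ j)
        + (\<Sum>i\<in>UNIV. \<Sum>j\<in>UNIV. flow_bound r \<xi> i j * y $ i $ j * \<rho> $ i $ j)"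
    using assms(7-9) by (intro production_weak_duality) auto
  also have "(\<Sum>i\<in>UNIV. \<Sum>j\<in>UNIV. flow_bound r \<xi> i j * y $ i $ j * \<rho> $ i $ j)
      = (\<Sum>(i, j)\<in>UNIV. flow_bound r \<xi> i j * \<rho> $ i $ j * y $ i $ j)"
    by (simp add: sum.cartesian_product mult_ac)
  finally show ?thesis
    using assms(6) by linarith
qed

end
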